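(* Let $V:\mathcal{Q}_2\to\mathbb{R}_+$ be defined by $V(\nu)=\mathrm{d}_2(\nu,\gamma)$. Then $V$ satisfies the following. (1) $V(\gamma)=0$, and $V(\nu)>0$ for every $\nu\in\mathcal{Q}_2\setminus\{\gamma\}$. (2) $V$ is continuous on $(\mathcal{Q}_2,\mathrm{d}_2)$. (3) $V$ has bounded level sets: for every $c\ge 0$ the set $\{\nu\in\mathcal{Q}_2: V(\nu)\le c\}$ is bounded in $(\mathcal{Q}_2,\mathrm{d}_2)$. (4) $V(T\nu)<V(\nu)$ for every $\nu\in\mathcal{Q}_2\setminus\{\gamma\}$.
   Context: $\mathcal{Q}_2$ is the set of Borel probability measures $\nu$ on $\mathbb{R}$ with finite second moment, mean $0$ and variance $1$: $\int x\,d\nu(x)=0$, $\int x^2\,d\nu(x)=1$. For a probability measure $\nu$ on $\mathbb{R}$, $\varphi_\nu(\xi)=\int e^{\mathrm{i}x\xi}\,d\nu(x)$ is its characteristic function. For $\nu,\mu\in\mathcal{Q}_2$, $$\mathrm{d}_2(\nu,\mu)=\sup_{\xi\in\mathbb{R}\setminus\{0\}}\frac{|\varphi_\nu(\xi)-\varphi_\mu(\xi)|}{\xi^2},$$ which is a finite distance on $\mathcal{Q}_2$. The renormalization map $T$ sends a probability measure $\nu$ on $\mathbb{R}$ to the law $T\nu$ of $(X+Y)/\sqrt{2}$, where $X,Y$ are independent random variables of law $\nu$; $T$ maps $\mathcal{Q}_2$ into itself. $\gamma$ is the standard normal law $\mathcal{N}(0,1)$, $d\gamma(x)=\frac{1}{\sqrt{2\pi}}e^{-x^2/2}\,dx$,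 which belongs to $\mathcal{Q}_2$. *)

theory Defs
  imports "HOL-Probability.Probability"
begin

definition Q2 :: "real measure set" where
  "Q2 = {\<nu>. real_distribution \<nu> \<and> integrable \<nu> (\<lambda>x. x\<^sup>2)
             \<and> (LINT x|\<nu>. x) = 0 \<and> (LINT x|\<nu>. x\<^sup>2) = 1}"

text \<open>The supremum is a real one; lemma \<open>bdd_above_d2\<close> below shows that it is finite for measures
  in \<^term>\<open>Q2\<close>. The value 0 elsewhere is arbitrary, and only serves the locale
  \<^locale>\<open>Metric_space\<close>, which asks for nonnegativity and symmetry on the whole type.\<close>

definition d2 :: "real measure \<Rightarrow> real measure \<Rightarrow> real" where
  "d2 \<nu> \<mu> = (if \<nu> \<in> Q2 \<and> \<mu> \<in> Q2
     then (SUP \<xi>\<in>UNIV - {0}. cmod (char \<nu> \<xi> - char \<mu> \<xi>) / \<xi>\<^sup>2) else 0)"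

text \<open>The two independent variables of law \<open>\<nu>\<close> are the coordinates of \<open>\<nu> \<Otimes>\<^sub>M \<nu>\<close>;
  see lemma \<open>renorm_eq_distr\<close> for arbitrary ones.\<close>

definition renorm :: "real measure \<Rightarrow> real measure" where
  "renorm \<nu> = distr (\<nu> \<Otimes>\<^sub>M \<nu>) borel (\<lambda>(x, y). (x + y) / sqrt 2)"

definition V :: "real measure \<Rightarrow> real" where
  "V \<nu> = d2 \<nu> std_normal_distribution"

lemma (in prob_space) renorm_eq_distr:
  fixes X Y :: "'a \<Rightarrow> real"
  assumes "indep_var borel X borel Y" "distr M borel X = \<nu>" "distr M borel Y = \<nu>"
  shows "distr M borel (\<lambda>\<omega>. (X \<omega> + Y \<omega>) / sqrt 2) = renorm \<nu>"
proof -
  have [measurable]: "X \<in> borel_measurable M" "Y \<in> borel_measurable M"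
    using assms(1) by (auto dest: indep_var_rv1 indep_var_rv2)
  have "\<nu> \<Otimes>\<^sub>M \<nu> = distr M (borel \<Otimes>\<^sub>M borel) (\<lambda>\<omega>. (X \<omega>, Y \<omega>))"
    using assms indep_var_distribution_eq by metis
  then show ?thesis
    by (simp add: renorm_def distr_distr o_def)
qed

lemma std_normal_in_Q2: "std_normal_distribution \<in> Q2"
  using real_dist_normal_dist std_normal_distribution_even_moments[of 1]
    integral_std_normal_distribution_moment_odd[of 1]
  by (simp add: Q2_def fact_numeral)

lemma char_near_Q2:
  assumes "\<nu> \<in> Q2"
  shows "cmod (char \<nu> t - (1 - t\<^sup>2 / 2)) \<le> t\<^sup>2"
proof -
  interpret real_distribution \<nu> using assms by (simp add: Q2_def)
  have sq: "integrable \<nu> (\<lambda>x. x\<^sup>2)" "expectation (\<lambda>x. x) = 0" "expectation (\<lambda>x. x\<^sup>2) = 1"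
    using assms by (auto simp: Q2_def)
  have id: "integrable \<nu> (\<lambda>x. x)"
    by (rule square_integrable_imp_integrable) (use sq in auto)
  have "cmod (char \<nu> t - (1 - t\<^sup>2 * 1 / 2))
      \<le> (t\<^sup>2 / 6) * expectation (\<lambda>x. min (6 * x\<^sup>2) (\<bar>t\<bar> * \<bar>x\<bar> ^ 3))"
    using char_approx3[OF id sq(2) sq(1), of 1 t] sq by simp
  also have "\<dots> \<le> (t\<^sup>2 / 6) * expectation (\<lambda>x. 6 * x\<^sup>2)"
  proof (intro mult_left_mono integral_mono)
    show "integrable \<nu> (\<lambda>x. min (6 * x\<^sup>2) (\<bar>t\<bar> * \<bar>x\<bar> ^ 3))"
      by (rule Bochner_Integration.integrable_bound[OF integrable_mult_right[OF sq(1), of 6]]) auto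
  qed (use sq in auto)
  also have "\<dots> = t\<^sup>2" using sq by simp
  finally show ?thesis by simp
qed

lemma bdd_above_d2:
  assumes "\<nu> \<in> Q2" "\<mu> \<in> Q2"
  shows "bdd_above ((\<lambda>\<xi>. cmod (char \<nu> \<xi> - char \<mu> \<xi>) / \<xi>\<^sup>2) ` (UNIV - {0}))"
proof (rule bdd_aboveI2)
  fix \<xi> :: real assume "\<xi> \<in> UNIV - {0}"
  have "cmod (char \<nu> \<xi> - char \<mu> \<xi>) \<le> 2 * \<xi>\<^sup>2"
    using char_near_Q2[OF assms(1), of \<xi>] char_near_Q2[OF assms(2), of \<xi>]
      norm_triangle_ineq4[of "char \<nu> \<xi> - (1 - \<xi>\<^sup>2 / 2)" "char \<mu> \<xi> - (1 - \<xi>\<^sup>2 / 2)"]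
    by simp
  then show "cmod (char \<nu> \<xi> - char \<mu> \<xi>) / \<xi>\<^sup>2 \<le> 2"
    using \<open>\<xi> \<in> UNIV - {0}\<close> by (simp add: divide_le_eq)
qed

lemma d2_upper:
  assumes "\<nu> \<in> Q2" "\<mu> \<in> Q2" "\<xi> \<noteq> 0"
  shows "cmod (char \<nu> \<xi> - char \<mu> \<xi>) / \<xi>\<^sup>2 \<le> d2 \<nu> \<mu>"
  using assms cSUP_upper[OF _ bdd_above_d2[OF assms(1,2)], of \<xi>] by (simp add: d2_def)

lemma Metric_space_d2: "Metric_space Q2 d2"
proof
  show nn: "0 \<le> d2 \<nu> \<mu>" for \<nu> \<mu>
  proof (cases "\<nu> \<in> Q2 \<and> \<mu> \<in> Q2")
    case True
    have "0 \<le> cmod (char \<nu> 1 - char \<mu> 1) / 1\<^sup>2" by simp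
    also have "\<dots> \<le> d2 \<nu> \<mu>" using True by (intro d2_upper) auto
    finally show ?thesis .
  qed (auto simp: d2_def)
  show "d2 \<nu> \<mu> = d2 \<mu> \<nu>" for \<nu> \<mu>
    by (auto simp: d2_def norm_minus_commute)
  show "d2 \<nu> \<mu> = 0 \<longleftrightarrow> \<nu> = \<mu>" if in_Q: "\<nu> \<in> Q2" "\<mu> \<in> Q2" for \<nu> \<mu>
  proof
    assume z: "d2 \<nu> \<mu> = 0"
    have rd: "real_distribution \<nu>" "real_distribution \<mu>" using in_Q by (auto simp: Q2_def)
    have "char \<nu> \<xi> = char \<mu> \<xi>" for \<xi>
    proof (cases "\<xi> = 0")
      case True
      then show ?thesis using rd by (simp add: real_distribution.char_zero)
    next
      case False
      then show ?thesis
        using d2_upper[OF in_Q False] z by (simp add: divide_le_0_iff)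
    qed
    then show "\<nu> = \<mu>" using Levy_uniqueness[OF rd] by blast
  next
    assume "\<nu> = \<mu>"
    have "UNIV - {0::real} \<noteq> {}" by (metis DiffI UNIV_I empty_iff singletonD zero_neq_one)
    then show "d2 \<nu> \<mu> = 0" using \<open>\<nu> = \<mu>\<close> by (simp add: d2_def)
  qed
  show "d2 \<nu> \<rho> \<le> d2 \<nu> \<mu> + d2 \<mu> \<rho>"
    if in_Q: "\<nu> \<in> Q2" "\<mu> \<in> Q2" "\<rho> \<in> Q2" for \<nu> \<mu> \<rho>
  proof -
    have "(SUP \<xi>\<in>UNIV - {0}. cmod (char \<nu> \<xi> - char \<rho> \<xi>) / \<xi>\<^sup>2) \<le> d2 \<nu> \<mu> + d2 \<mu> \<rho>"
    proof (rule cSUP_least)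
      show "UNIV - {0::real} \<noteq> {}" by (metis DiffI UNIV_I empty_iff singletonD zero_neq_one)
      fix \<xi> :: real assume "\<xi> \<in> UNIV - {0}"
      then have \<xi>: "\<xi> \<noteq> 0" by simp
      have "cmod (char \<nu> \<xi> - char \<rho> \<xi>) / \<xi>\<^sup>2
          \<le> cmod (char \<nu> \<xi> - char \<mu> \<xi>) / \<xi>\<^sup>2 + cmod (char \<mu> \<xi> - char \<rho> \<xi>) / \<xi>\<^sup>2"
        using norm_triangle_ineq[of "char \<nu> \<xi> - char \<mu> \<xi>" "char \<mu> \<xi> - char \<rho> \<xi>"]
        by (simp add: add_divide_distrib[symmetric] divide_right_mono)
      also have "\<dots> \<le> d2 \<nu> \<mu> + d2 \<mu> \<rho>"
        using d2_upper[OF in_Q(1,2) \<xi>] d2_upper[OF in_Q(2,3) \<xi>] by simp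
      finally show "cmod (char \<nu> \<xi> - char \<rho> \<xi>) / \<xi>\<^sup>2 \<le> d2 \<nu> \<mu> + d2 \<mu> \<rho>" .
    qed
    then show ?thesis using in_Q by (simp add: d2_def)
  qed
qed

lemma renorm_in_Q2:
  assumes "\<nu> \<in> Q2"
  shows "renorm \<nu> \<in> Q2"
proof -
  interpret real_distribution \<nu> using assms by (simp add: Q2_def)
  interpret P: pair_prob_space \<nu> \<nu> ..
  have sq: "integrable \<nu> (\<lambda>x. x\<^sup>2)" "expectation (\<lambda>x. x) = 0" "expectation (\<lambda>x. x\<^sup>2) = 1"
    using assms by (auto simp: Q2_def)
  have id: "integrable \<nu> (\<lambda>x. x)"
    by (rule square_integrable_imp_integrable) (use sq in auto)
  have m[measurable]: "fst \<in> borel_measurable (\<nu> \<Otimes>\<^sub>M \<nu>)" "snd \<in> borel_measurable (\<nu> \<Otimes>\<^sub>M \<nu>)"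
    by (auto simp: measurable_cong_sets[OF refl events_eq_borel, symmetric])
  have f: "distr (\<nu> \<Otimes>\<^sub>M \<nu>) borel fst = \<nu>"
    using distr_pair_fst[of \<nu>] by (simp cong: distr_cong)
  have "distr (\<nu> \<Otimes>\<^sub>M \<nu>) (\<nu> \<Otimes>\<^sub>M \<nu>) (\<lambda>(x, y). (y, x)) = \<nu> \<Otimes>\<^sub>M \<nu>"
    using P.distr_pair_swap by simp
  then have "distr (\<nu> \<Otimes>\<^sub>M \<nu>) borel snd
      = distr (distr (\<nu> \<Otimes>\<^sub>M \<nu>) (\<nu> \<Otimes>\<^sub>M \<nu>) (\<lambda>(x, y). (y, x))) borel snd"
    by simp
  also have "\<dots> = distr (\<nu> \<Otimes>\<^sub>M \<nu>) borel fst"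
    by (subst distr_distr) (auto simp: o_def case_prod_beta)
  finally have s: "distr (\<nu> \<Otimes>\<^sub>M \<nu>) borel snd = \<nu>" using f by simp
  have "sets (\<nu> \<Otimes>\<^sub>M \<nu>) = sets (borel \<Otimes>\<^sub>M borel)"
    by (intro sets_pair_measure_cong events_eq_borel)
  then have "distr (\<nu> \<Otimes>\<^sub>M \<nu>) (borel \<Otimes>\<^sub>M borel) (\<lambda>p. (fst p, snd p)) = \<nu> \<Otimes>\<^sub>M \<nu>"
    by (simp add: distr_id2)
  then have ind: "P.indep_var borel fst borel snd"
    by (simp add: P.indep_var_distribution_eq f s m)
  have tr: "integrable (\<nu> \<Otimes>\<^sub>M \<nu>) (\<lambda>p. g (fst p))" "P.expectation (\<lambda>p. g (fst p)) = expectation g"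
    "integrable (\<nu> \<Otimes>\<^sub>M \<nu>) (\<lambda>p. g (snd p))" "P.expectation (\<lambda>p. g (snd p)) = expectation g"
    if "integrable \<nu> g" "g \<in> borel_measurable borel" for g :: "real \<Rightarrow> real"
    using that integrable_distr_eq[OF m(1), of g] integrable_distr_eq[OF m(2), of g]
      integral_distr[OF m(1), of g] integral_distr[OF m(2), of g]
    by (auto simp: f s)
  have I1: "integrable (\<nu> \<Otimes>\<^sub>M \<nu>) fst" "P.expectation fst = 0"
    and I2: "integrable (\<nu> \<Otimes>\<^sub>M \<nu>) snd" "P.expectation snd = 0"
    using tr[OF id] sq(2) by auto
  have I12: "integrable (\<nu> \<Otimes>\<^sub>M \<nu>) (\<lambda>p. fst p * snd p)" "P.expectation (\<lambda>p. fst p * snd p) = 0"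
    using P.indep_var_integrable[OF ind I1(1) I2(1)]
      P.indep_var_lebesgue_integral[OF ind I1(1) I2(1)] I1 by auto
  have J: "integrable (\<nu> \<Otimes>\<^sub>M \<nu>) (\<lambda>p. (fst p)\<^sup>2)" "P.expectation (\<lambda>p. (fst p)\<^sup>2) = 1"
    "integrable (\<nu> \<Otimes>\<^sub>M \<nu>) (\<lambda>p. (snd p)\<^sup>2)" "P.expectation (\<lambda>p. (snd p)\<^sup>2) = 1"
    using tr[OF sq(1)] sq(3) by auto
  define Z where "Z = (\<lambda>p::real \<times> real. (fst p + snd p) / sqrt 2)"
  have Zm[measurable]: "Z \<in> borel_measurable (\<nu> \<Otimes>\<^sub>M \<nu>)" unfolding Z_def by simp
  have R: "renorm \<nu> = distr (\<nu> \<Otimes>\<^sub>M \<nu>) borel Z"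
    by (simp add: renorm_def Z_def case_prod_unfold)
  have Z2: "(Z p)\<^sup>2 = (1/2) * (fst p)\<^sup>2 + fst p * snd p + (1/2) * (snd p)\<^sup>2" for p
    by (simp add: Z_def power_divide power2_sum)
  have "real_distribution (renorm \<nu>)"
    unfolding R by (rule P.real_distribution_distr) (rule Zm)
  moreover have "integrable (renorm \<nu>) (\<lambda>x. x\<^sup>2)"
    unfolding R using J I12 by (simp add: integrable_distr_eq Z2)
  moreover have "(LINT x|renorm \<nu>. x) = 0"
    unfolding R using I1 I2 by (simp add: integral_distr) (simp add: Z_def)
  moreover have "(LINT x|renorm \<nu>. x\<^sup>2) = 1"
    unfolding R using J I12 by (simp add: integral_distr Z2)
  ultimately show ?thesis by (simp add: Q2_def)
qed

end

(* Write g for the characteristic function of the standard normal law, \<phi> for that of \<nu>, and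
   h(\<xi>) = |\<phi>(\<xi>) - g(\<xi>)| / \<xi>\<^sup>2. The characteristic function of T \<nu> at \<xi> is \<phi>(\<xi> / sqrt 2)\<^sup>2, and g is fixed
   by this operation. Factoring the difference of squares bounds the quotient for T \<nu> at
   \<xi> = sqrt 2 \<eta> by h(\<eta>) (1 + g(\<eta>)) / 2. Away from 0 the second factor stays below a constant
   less than 1; near 0 the second-order expansions of \<phi> and g agree, so h itself is small. *)

theory Submission
  imports Defs
begin

text \<open>In the sum factor, only modulus at most 1 is used for \<open>char \<nu> t\<close>. The
  Gaussian term is kept exactly, because its decay away from 0 yields the strict
  contraction.\<close>

lemma cmod_char_diff_squares_le:
  assumes "real_distribution \<nu>"
  shows "cmod ((char \<nu> t)\<^sup>2 - (char std_normal_distribution t)\<^sup>2)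
    \<le> cmod (char \<nu> t - char std_normal_distribution t) * (1 + exp (- (t\<^sup>2) / 2))"
proof -
  interpret real_distribution \<nu> by fact
  let ?g = "char std_normal_distribution t"
  have "cmod ?g = exp (- (t\<^sup>2) / 2)"
    by (simp add: char_std_normal_distribution)
  then have "cmod (char \<nu> t + ?g) \<le> 1 + exp (- (t\<^sup>2) / 2)"
    using norm_triangle_ineq[of "char \<nu> t" ?g] cmod_char_le_1[of t] by linarith
  moreover have "(char \<nu> t)\<^sup>2 - ?g\<^sup>2 = (char \<nu> t - ?g) * (char \<nu> t + ?g)"
    by (simp add: power2_eq_square algebra_simps)
  ultimately show ?thesis
    by (simp add: norm_mult mult_left_mono)
qed

text \<open>By Fubini: the exponential of a sum is a product of functions of one coordinate each,
  and it is integrable since its modulus is 1.\<close>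

lemma char_renorm:
  assumes "real_distribution \<nu>"
  shows "char (renorm \<nu>) t = (char \<nu> (t / sqrt 2))\<^sup>2"
proof -
  interpret real_distribution \<nu> by fact
  interpret P: pair_prob_space \<nu> \<nu> ..
  let ?s = "t / sqrt 2"
  let ?f = "\<lambda>p. iexp (?s * fst p) * iexp (?s * snd p)"
  have [measurable]: "fst \<in> borel_measurable (\<nu> \<Otimes>\<^sub>M \<nu>)" "snd \<in> borel_measurable (\<nu> \<Otimes>\<^sub>M \<nu>)"
    by (auto simp: measurable_cong_sets[OF refl events_eq_borel, symmetric])
  have f: "integrable (\<nu> \<Otimes>\<^sub>M \<nu>) ?f"
    by (rule P.integrable_const_bound[where B = 1]) (auto simp: norm_mult)
  have "char (renorm \<nu>) t = (CLINT p|\<nu> \<Otimes>\<^sub>M \<nu>. iexp (t * ((fst p + snd p) / sqrt 2)))"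
    unfolding renorm_def char_def case_prod_beta by (rule integral_distr) auto
  also have "\<dots> = (CLINT p|\<nu> \<Otimes>\<^sub>M \<nu>. ?f p)"
    by (rule Bochner_Integration.integral_cong)
      (auto simp flip: exp_add simp: add_divide_distrib algebra_simps)
  also have "\<dots> = (CLINT x|\<nu>. CLINT y|\<nu>. ?f (x, y))"
    by (rule P.integral_fst'[OF f, symmetric])
  also have "\<dots> = (char \<nu> ?s)\<^sup>2"
    by (simp add: char_def power2_eq_square)
  finally show ?thesis .
qed

text \<open>Sharpens the bound of \<open>char_near_Q2\<close> to a remainder o(t^2). Keeping the
  minimum inside the expectation makes this possible with second moments only.\<close>

lemma char_expansion_Q2:
  assumes "\<nu> \<in> Q2"
  shows "((\<lambda>t. cmod (char \<nu> t - (1 - t\<^sup>2 / 2)) / t\<^sup>2) \<longlongrightarrow> 0) (at 0)"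
proof -
  interpret real_distribution \<nu> using assms by (simp add: Q2_def)
  have sq: "integrable \<nu> (\<lambda>x. x\<^sup>2)" "expectation (\<lambda>x. x) = 0" "expectation (\<lambda>x. x\<^sup>2) = 1"
    using assms by (auto simp: Q2_def)
  have id: "integrable \<nu> (\<lambda>x. x)"
    by (rule square_integrable_imp_integrable) (use sq in auto)
  let ?E = "\<lambda>t. expectation (\<lambda>x. min (6 * x\<^sup>2) (\<bar>t\<bar> * \<bar>x\<bar> ^ 3))"
  have "cmod (char \<nu> t - (1 - t\<^sup>2 / 2)) / t\<^sup>2 \<le> ?E t / 6" if "t \<noteq> 0" for t
    using char_approx3[OF id sq(2) sq(1), of 1 t] sq that by (simp add: field_simps)
  then have le: "eventually (\<lambda>t. norm (cmod (char \<nu> t - (1 - t\<^sup>2 / 2)) / t\<^sup>2) \<le> ?E t / 6) (at 0)"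
    by (auto simp: eventually_at_filter)
  \<comment> \<open>For fixed x the cubic argument of the minimum vanishes with t.\<close>
  have "((\<lambda>t. min (6 * x\<^sup>2) (\<bar>t\<bar> * \<bar>x\<bar> ^ 3)) \<longlongrightarrow> 0) (at 0)" for x :: real
    by (rule tendsto_eq_intros refl | simp)+
  \<comment> \<open>Dominated convergence along an arbitrary sequence tending to 0; the quadratic
    argument of the minimum is the integrable bound.\<close>
  then have "(\<lambda>n. ?E (X n)) \<longlonglongrightarrow> expectation (\<lambda>x. 0)"
    if "filterlim X (at 0) sequentially" for X :: "nat \<Rightarrow> real"
    by (intro integral_dominated_convergence[where w = "\<lambda>x. 6 * x\<^sup>2"])
      (use sq filterlim_compose[OF _ that] in auto)
  then have "(?E \<longlongrightarrow> 0) (at 0)"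
    by (auto simp: tendsto_at_iff_sequentially filterlim_at o_def)
  then have "((\<lambda>t. ?E t / 6) \<longlongrightarrow> 0) (at 0)"
    by (rule tendsto_divide_zero)
  then show ?thesis
    by (rule Lim_null_comparison[OF le])
qed

text \<open>Mean 0 and variance 1 give both laws the same quadratic expansion, so only the two
  remainders survive.\<close>

lemma char_diff_Q2:
  assumes "\<nu> \<in> Q2" "\<mu> \<in> Q2"
  shows "((\<lambda>t. cmod (char \<nu> t - char \<mu> t) / t\<^sup>2) \<longlongrightarrow> 0) (at 0)"
proof (rule Lim_null_comparison)
  let ?r = "\<lambda>\<nu> t. cmod (char \<nu> t - (1 - t\<^sup>2 / 2)) / t\<^sup>2"
  show "((\<lambda>t. ?r \<nu> t + ?r \<mu> t) \<longlongrightarrow> 0) (at 0)"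
    using tendsto_add[OF char_expansion_Q2[OF assms(1)] char_expansion_Q2[OF assms(2)]] by simp
  have "cmod (char \<nu> t - char \<mu> t) / t\<^sup>2 \<le> ?r \<nu> t + ?r \<mu> t" for t
    using norm_triangle_ineq4[of "char \<nu> t - (1 - t\<^sup>2 / 2)" "char \<mu> t - (1 - t\<^sup>2 / 2)"]
    by (simp add: divide_right_mono flip: add_divide_distrib)
  then show "eventually (\<lambda>t. norm (cmod (char \<nu> t - char \<mu> t) / t\<^sup>2) \<le> ?r \<nu> t + ?r \<mu> t) (at 0)"
    by simp
qed

lemma V_pos:
  assumes "\<nu> \<in> Q2" "\<nu> \<noteq> std_normal_distribution"
  shows "V \<nu> > 0"
proof -
  interpret Q2: Metric_space Q2 d2
    by (rule Metric_space_d2)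
  show ?thesis
    using assms std_normal_in_Q2 by (simp add: V_def)
qed

text \<open>Strict inequality at each \<xi> could be lost in the supremum, so one factor
  \<open>c < 1\<close>, depending on \<nu>, is found that serves all \<xi>.\<close>

lemma V_renorm_less:
  assumes "\<nu> \<in> Q2" "\<nu> \<noteq> std_normal_distribution"
  shows "V (renorm \<nu>) < V \<nu>"
proof -
  define s where "s = V \<nu>"
  have s: "s > 0"
    using V_pos[OF assms] by (simp add: s_def)
  have rd: "real_distribution \<nu>"
    using assms by (simp add: Q2_def)
  let ?g = "char std_normal_distribution"
  define h where "h t = cmod (char \<nu> t - ?g t) / t\<^sup>2" for t
  have h0: "h t \<ge> 0" for t
    by (simp add: h_def)
  have hs: "h t \<le> s" if "t \<noteq> 0" for t
    using d2_upper[OF assms(1) std_normal_in_Q2 that] by (simp add: h_def s_def V_def)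
  \<comment> \<open>The threshold \<open>s / 2\<close> fits the lower bound
    \<open>1 / 2 \<le> c\<close> below, so that the region near 0 also obeys the bound
    \<open>s * c\<close>.\<close>
  have "eventually (\<lambda>t. h t < s / 2) (at 0)"
    unfolding h_def
    by (rule order_tendstoD(2)[OF char_diff_Q2[OF assms(1) std_normal_in_Q2]]) (use s in simp)
  then obtain \<delta> where \<delta>: "\<delta> > 0" "\<And>t. t \<noteq> 0 \<Longrightarrow> \<bar>t\<bar> < \<delta> \<Longrightarrow> h t < s / 2"
    by (auto simp: eventually_at dist_real_def)
  \<comment> \<open>The value at \<delta> of the factor (1 + g) / 2, which decreases in the modulus
    of its argument and so is at most \<open>c\<close> outside the \<delta>-neighbourhood of
    0.\<close>
  define c where "c = (1 + exp (- (\<delta>\<^sup>2) / 2)) / 2"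
  have c: "1 / 2 \<le> c" "c < 1"
    using \<delta>(1) by (simp_all add: c_def)
  have bound: "cmod (char (renorm \<nu>) \<xi> - ?g \<xi>) / \<xi>\<^sup>2 \<le> s * c" if "\<xi> \<noteq> 0" for \<xi>
  proof -
    define t where "t = \<xi> / sqrt 2"
    have t: "t \<noteq> 0" "\<xi>\<^sup>2 = 2 * t\<^sup>2"
      using that by (simp_all add: t_def power_divide)
    have g: "?g \<xi> = (?g t)\<^sup>2"
      unfolding char_std_normal_distribution t(2)
      by (simp flip: of_real_power exp_double)
    have e: "0 \<le> exp (- (t\<^sup>2) / 2)" "exp (- (t\<^sup>2) / 2) \<le> 1"
      by simp_all
    have "cmod (char (renorm \<nu>) \<xi> - ?g \<xi>) / \<xi>\<^sup>2 = cmod ((char \<nu> t)\<^sup>2 - (?g t)\<^sup>2) / (2 * t\<^sup>2)"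
      by (simp add: char_renorm[OF rd] g t(2) flip: t_def)
    also have "\<dots> \<le> cmod (char \<nu> t - ?g t) * (1 + exp (- (t\<^sup>2) / 2)) / (2 * t\<^sup>2)"
      by (intro divide_right_mono cmod_char_diff_squares_le rd) simp
    \<comment> \<open>The 1/2 in the factor comes from the rescaling \<xi>^2 = 2 t^2.\<close>
    also have "\<dots> = h t * ((1 + exp (- (t\<^sup>2) / 2)) / 2)"
      by (simp add: h_def)
    also have "\<dots> \<le> s * c"
    proof (cases "\<bar>t\<bar> < \<delta>")
      case True
      have "h t * ((1 + exp (- (t\<^sup>2) / 2)) / 2) \<le> h t * 1"
        using h0 e by (intro mult_left_mono) auto
      also have "\<dots> \<le> s * (1 / 2)"
        using \<delta>(2)[OF t(1) True] by simp
      also have "\<dots> \<le> s * c"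
        using s c by (intro mult_left_mono) auto
      finally show ?thesis .
    next
      case False
      then have "\<delta>\<^sup>2 \<le> t\<^sup>2"
        using \<delta>(1) by (simp add: abs_le_square_iff[symmetric])
      then have "(1 + exp (- (t\<^sup>2) / 2)) / 2 \<le> c"
        by (simp add: c_def)
      then show ?thesis
        using hs[OF t(1)] h0 s e by (intro mult_mono) auto
    qed
    finally show ?thesis .
  qed
  have "UNIV - {0::real} \<noteq> {}"
    by (metis DiffI UNIV_I empty_iff singletonD zero_neq_one)
  then have "V (renorm \<nu>) \<le> s * c"
    using renorm_in_Q2[OF assms(1)] std_normal_in_Q2 bound
    by (auto simp: V_def d2_def intro!: cSUP_least)
  also have "\<dots> < s"
    using s c by simp
  finally show ?thesis
    by (simp add: s_def)
qed

theorem theorem2p1: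
  shows "(V std_normal_distribution = 0 \<and> (\<forall>\<nu>\<in>Q2 - {std_normal_distribution}. V \<nu> > 0))
    \<and> continuous_map (Metric_space.mtopology Q2 d2) (top_of_set {0..}) V
    \<and> (\<forall>c\<ge>0. Metric_space.mbounded Q2 d2 {\<nu>\<in>Q2. V \<nu> \<le> c})
    \<and> (\<forall>\<nu>\<in>Q2 - {std_normal_distribution}. V (renorm \<nu>) < V \<nu>)"
proof (intro conjI ballI allI impI)
  interpret Q2: Metric_space Q2 d2
    by (rule Metric_space_d2)
  show "V std_normal_distribution = 0"
    using std_normal_in_Q2 by (simp add: V_def)
  \<comment> \<open>\<open>V\<close> is the distance to a fixed point, and a metric is continuous in
    each argument.\<close>
  have "continuous_map Q2.mtopology euclideanreal V"
    using continuous_map_mdist[of Q2.mtopology "metric (Q2, d2)" "\<lambda>\<nu>. \<nu>" "\<lambda>_. std_normal_distribution"]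
      std_normal_in_Q2 by (simp add: V_def[abs_def] Q2.mtopology_of continuous_map_id[unfolded id_def])
  then show "continuous_map Q2.mtopology (top_of_set {0..}) V"
    by (simp add: continuous_map_in_subtopology V_def image_subset_iff)
  \<comment> \<open>The sublevel set lies in the closed ball of radius \<open>c\<close> about the
    Gaussian.\<close>
  show "Q2.mbounded {\<nu> \<in> Q2. V \<nu> \<le> c}" for c
    using std_normal_in_Q2
    by (auto simp: Q2.mbounded_def V_def Q2.commute intro!: exI[of _ std_normal_distribution] exI[of _ c])
qed (auto intro: V_pos V_renorm_less)

end
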